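(* Let $k\ge 1$, let $\beta\in\mathbb{R}^k$, and let $z=[z_c,z_t]$ be a random vector in $\mathbb{R}^k$ with distribution $p(z)$ (the features at a domain $t$, consisting of an invariant block $z_c$ and a dynamic block $z_t$). Let $y\in\{+1,-1\}$ be a random label whose conditional distribution given $z$ is $$y=\begin{cases}+1 & \text{with probability } \sigma(\beta^T z),\\ -1 & \text{with probability } \sigma(-\beta^T z).\end{cases}$$ Assume that $P(\beta_S^T z_S\neq 0)>0$ for every nonempty $S\subseteq[k]$, and that no feature (coordinate of $z$) can be written as a linear combination of the other features. Then, for any such distribution $p(z)$ and every strict subset $S\subsetneq[k]$: (1) the classifier $f(z)=\sigma(\beta_S^T z_S)$ has strictly higher risk with logistic loss than the Bayes classifier $f^*(z)=\sigma(\beta^T z)$; (2) if, in addition, with non-zero probability $\beta_{-S}^T z_{-S}$ has greater magnitude than, and opposite sign of, $\beta_S^T z_S$, then $f$ also has strictly higher risk with 0-1 loss than $f^*$.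
   Context: Notation: $[k]=\{1,\dots,k\}$ and $\sigma(u)=1/(1+e^{-u})$ is the logistic sigmoid. For $S\subseteq[k]$, $\beta_S$ and $z_S$ denote the subvectors of $\beta$ and $z$ with coordinates indexed by $S$, and $\beta_{-S}, z_{-S}$ those with coordinates indexed by $[k]\setminus S$; thus $\beta^T z=\beta_S^T z_S+\beta_{-S}^T z_{-S}$ (with $\beta_\emptyset^T z_\emptyset=0$). A classifier has the form $f(z)=\sigma(h(z))$, where $h(z)\in\mathbb{R}$ is its score and $f(z)$ is its predicted probability that $y=+1$. Its risk with logistic loss is $\mathbb{E}_{(z,y)}[-\log\sigma(y\,h(z))]=\mathbb{E}_{(z,y)}[\log(1+e^{-y h(z)})]$, taking values in $[0,\infty]$. For 0-1 loss the classifier predicts the label $\operatorname{sign}(h(z))\in\{+1,-1\}$ (with any fixed convention in $\{+1,-1\}$ for $\operatorname{sign}(0)$), and its risk is $P(\operatorname{sign}(h(z))\neq y)$. "No feature can be written as a linear combination of the other features" means: there are no index $i\in[k]$ and real coefficients $(c_j)_{j\ne i}$ such that $z_i=\sum_{j\neq i}c_j z_j$ almost surely. *)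

theory Defs
  imports "HOL-Probability.Probability"
begin

definition sigmoid :: "real \<Rightarrow> real" where
  "sigmoid u = 1 / (1 + exp (- u))"

(* beta_S^T z_S; the coordinate set [k] is the finite index type 'k, so beta_{-S}^T z_{-S} is
   sub_inner (- S) beta z, and the full inner product is the library's beta \<bullet> z. *)
definition sub_inner :: "'k set \<Rightarrow> real ^ 'k \<Rightarrow> real ^ 'k \<Rightarrow> real" where
  "sub_inner S \<beta> z = (\<Sum>i\<in>S. \<beta> $ i * z $ i)"

(* A classifier f = sigmoid o h is represented by its score h. The logistic loss is positive, and
   its expectation is taken in [0, \<infinity>] because it may diverge. *)
definition logistic_risk ::
  "'a measure \<Rightarrow> ('a \<Rightarrow> real ^ 'k) \<Rightarrow> ('a \<Rightarrow> real) \<Rightarrow> (real ^ 'k \<Rightarrow> real) \<Rightarrow> ennreal" where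
  "logistic_risk M z y h = (\<integral>\<^sup>+ \<omega>. ennreal (- ln (sigmoid (y \<omega> * h (z \<omega>)))) \<partial>M)"

(* The sign with values in {1, -1}, where s is the convention for the sign of 0. *)
definition sign_conv :: "real \<Rightarrow> real \<Rightarrow> real" where
  "sign_conv s u = (if u = 0 then s else sgn u)"

definition zero_one_risk ::
  "real \<Rightarrow> 'a measure \<Rightarrow> ('a \<Rightarrow> real ^ 'k) \<Rightarrow> ('a \<Rightarrow> real) \<Rightarrow> (real ^ 'k \<Rightarrow> real) \<Rightarrow> real" where
  "zero_one_risk s M z y h = \<P>(\<omega> in M. sign_conv s (h (z \<omega>)) \<noteq> y \<omega>)"

(* Conditional probability P(y = v | z) as a random variable, i.e. given the sigma-algebra
   generated by z. *)
definition label_prob_given ::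
  "'a measure \<Rightarrow> ('a \<Rightarrow> real ^ 'k) \<Rightarrow> ('a \<Rightarrow> real) \<Rightarrow> real \<Rightarrow> 'a \<Rightarrow> real" where
  "label_prob_given M z y v =
     real_cond_exp M (vimage_algebra (space M) z borel) (indicator {\<omega> \<in> space M. y \<omega> = v})"

end

theory Submission
  imports Defs
begin

text \<open>Conditioning on \<open>z\<close> turns either risk into the expectation of a pointwise conditional risk
  \<open>\<sigma>(u) l(1) + \<sigma>(-u) l(-1)\<close> with \<open>u = \<beta>\<^sup>T z\<close>. The score \<open>u\<close> minimises this
  for every value of \<open>z\<close>, and the minimum is at most \<open>ln 2\<close> (logistic) or \<open>1\<close> (0-1), hence has
  finite expectation. So it suffices that the minimum is strict with positive probability. For
  logistic loss it is strict wherever the two scores differ, by Gibbs' inequality, that is, wherever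
  \<open>\<beta>\<^bsub>-S\<^esub>\<^sup>T z\<^bsub>-S\<^esub> \<noteq> 0\<close>; for 0-1 loss it is strict wherever the
  two scores have opposite signs.\<close>

lemma sigmoid_pos [simp]: "0 < sigmoid u"
  and sigmoid_nonneg [simp]: "0 \<le> sigmoid u"
  and sigmoid_less_1 [simp]: "sigmoid u < 1"
  by (simp_all add: sigmoid_def add_pos_pos less_imp_le divide_simps)

lemma sigmoid_uminus: "sigmoid (- u) = 1 - sigmoid u"
proof -
  have "0 < 1 + exp u" "0 < 1 + exp (- u)"
    by (simp_all add: add_pos_pos)
  then show ?thesis
    by (simp add: sigmoid_def field_simps exp_minus)
qed

lemma sigmoid_less_iff [simp]: "sigmoid u < sigmoid v \<longleftrightarrow> u < v"
  by (simp add: sigmoid_def add_pos_pos divide_simps)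

lemma sigmoid_eq_iff [simp]: "sigmoid u = sigmoid v \<longleftrightarrow> u = v"
  by (metis less_irrefl linorder_neqE sigmoid_less_iff)

lemma measurable_sigmoid [measurable]: "sigmoid \<in> borel_measurable borel"
  unfolding sigmoid_def[abs_def] by measurable

lemma measurable_sub_inner [measurable]:
  "sub_inner T \<beta> \<in> borel_measurable borel" for \<beta> :: "real ^ 'k"
proof -
  have "continuous_on UNIV (sub_inner T \<beta>)"
    unfolding sub_inner_def[abs_def] by (intro continuous_intros)
  then show ?thesis
    by (rule borel_measurable_continuous_onI)
qed

lemma measurable_sign_conv [measurable]: "sign_conv s \<in> borel_measurable borel"
  unfolding sign_conv_def[abs_def] sgn_real_def by measurable

lemma inner_eq_sub_inner: "\<beta> \<bullet> x = sub_inner T \<beta> x + sub_inner (- T) \<beta> x"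
  for \<beta> :: "real ^ 'k"
  using sum.union_disjoint[of T "- T" "\<lambda>i. \<beta> $ i * x $ i"]
  by (simp add: inner_vec_def sub_inner_def Compl_partition)

text \<open>Gibbs' inequality for two-point distributions. The bound \<open>ln t \<le> t - 1\<close>
  is used at \<open>q / p\<close> and at \<open>(1 - q) / (1 - p)\<close>; after weighting, the
  right-hand sides \<open>q - p\<close> and \<open>p - q\<close> cancel. Strictness comes from the
  first use, since \<open>q / p\<close> differs from 1.\<close>

lemma binary_cross_entropy_less:
  fixes p q :: real
  assumes "0 < p" "p < 1" "0 < q" "q < 1" "p \<noteq> q"
  shows "p * - ln p + (1 - p) * - ln (1 - p) < p * - ln q + (1 - p) * - ln (1 - q)"
proof -
  have "ln (q / p) < q / p - 1"
    using ln_le_minus_one[of "q / p"] ln_eq_minus_one[of "q / p"] assms by fastforce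
  then have "p * ln (q / p) < q - p"
    using assms by (simp add: field_simps)
  moreover have "ln ((1 - q) / (1 - p)) \<le> (1 - q) / (1 - p) - 1"
    using assms by (intro ln_le_minus_one) simp
  then have "(1 - p) * ln ((1 - q) / (1 - p)) \<le> p - q"
    using assms by (simp add: field_simps)
  ultimately show ?thesis
    using assms by (simp add: ln_div algebra_simps)
qed

text \<open>Phrased with nonnegative integrals so that \<open>g\<close> may have infinite
  expectation, as a logistic loss can. The real conditional expectation of an indicator agrees a.e.
  with the \<open>ennreal\<close> one, whose defining property then applies.\<close>

lemma (in finite_measure_subalgebra) nn_integral_real_cond_exp_indicator:
  assumes [measurable]: "A \<in> sets M" "g \<in> borel_measurable F"
  shows "(\<integral>\<^sup>+ x. g x * ennreal (real_cond_exp M F (indicator A) x) \<partial>M)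
    = (\<integral>\<^sup>+ x. g x * indicator A x \<partial>M)"
proof -
  let ?I = "\<lambda>x. ennreal (indicator A x)"
  \<comment> \<open>The negative part in \<open>real_cond_exp\<close>: \<open>ennreal\<close>
    truncates negative reals to 0.\<close>
  have "AE x in M. 0 = nn_cond_exp M F (\<lambda>x. ennreal (- indicator A x)) x"
    by (rule nn_cond_exp_charact) (auto simp: ennreal_neg)
  moreover have "AE x in M. 1 = nn_cond_exp M F (\<lambda>x. 1) x"
    by (rule nn_cond_exp_charact) auto
  moreover have "AE x in M. nn_cond_exp M F ?I x \<le> nn_cond_exp M F (\<lambda>x. 1) x"
    by (rule nn_cond_exp_mono) (auto simp: indicator_def)
  ultimately have "AE x in M. ennreal (real_cond_exp M F (indicator A) x) = nn_cond_exp M F ?I x"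
  proof eventually_elim
    case (elim x)
    from elim(1) have "nn_cond_exp M F (\<lambda>x. ennreal (- indicator A x)) x = 0"
      by simp
    \<comment> \<open>Finiteness matters because \<open>real_cond_exp\<close> goes through
      \<open>enn2real\<close>, which sends \<open>\<top>\<close> to 0.\<close>
    moreover have "nn_cond_exp M F ?I x < \<top>"
      using elim(2,3) by (metis ennreal_one_less_top order.strict_trans1)
    ultimately show ?case
      by (simp add: real_cond_exp_def)
  qed
  then have "(\<integral>\<^sup>+ x. g x * ennreal (real_cond_exp M F (indicator A) x) \<partial>M)
      = (\<integral>\<^sup>+ x. g x * nn_cond_exp M F ?I x \<partial>M)"
    by (intro nn_integral_cong_AE) auto
  also have "\<dots> = (\<integral>\<^sup>+ x. g x * ?I x \<partial>M)"
    by (rule nn_cond_exp_intg) auto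
  finally show ?thesis
    by (simp add: ennreal_indicator)
qed

text \<open>The probabilistic model shared by both losses. The factor \<open>v\<close> merges the
  conditional probabilities of the two labels into one assumption.\<close>

locale logistic_label = prob_space M
  for M :: "'a measure" +
  fixes z :: "'a \<Rightarrow> real ^ 'k" and y :: "'a \<Rightarrow> real" and \<beta> :: "real ^ 'k"
  assumes z_measurable [measurable]: "z \<in> borel_measurable M"
    and y_measurable [measurable]: "y \<in> borel_measurable M"
    and y_values: "\<And>\<omega>. \<omega> \<in> space M \<Longrightarrow> y \<omega> = 1 \<or> y \<omega> = - 1"
    and label_prob: "\<And>v. v \<in> {1, - 1} \<Longrightarrow>
      AE \<omega> in M. label_prob_given M z y v \<omega> = sigmoid (v * (\<beta> \<bullet> z \<omega>))"
begin

text \<open>The conditional risk given \<open>z = x\<close>, where \<open>l v x\<close> is the loss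
  incurred at label \<open>v\<close> and features \<open>x\<close>.\<close>

definition cond_loss :: "(real \<Rightarrow> real ^ 'k \<Rightarrow> real) \<Rightarrow> real ^ 'k \<Rightarrow> real" where
  "cond_loss l x = sigmoid (\<beta> \<bullet> x) * l 1 x + sigmoid (- (\<beta> \<bullet> x)) * l (- 1) x"

text \<open>\<open>g (z \<omega>)\<close> is measurable for the sigma-algebra generated by
  \<open>z\<close>, so the label indicator may be replaced by its conditional expectation.\<close>

lemma nn_integral_loss_label:
  assumes v: "v \<in> {1, - 1}"
    and g [measurable]: "g \<in> borel_measurable borel" and g_nonneg: "\<And>x. 0 \<le> g x"
  shows "(\<integral>\<^sup>+ \<omega>. ennreal (g (z \<omega>)) * indicator {\<omega> \<in> space M. y \<omega> = v} \<omega> \<partial>M)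
    = (\<integral>\<^sup>+ \<omega>. ennreal (sigmoid (v * (\<beta> \<bullet> z \<omega>)) * g (z \<omega>)) \<partial>M)"
proof -
  let ?F = "vimage_algebra (space M) z borel"
  interpret F: finite_measure_subalgebra M ?F
  proof
    show "subalgebra M ?F"
      unfolding subalgebra_def by (simp add: sets_vimage_algebra2) (auto intro: measurable_sets)
  qed
  have [measurable]: "z \<in> borel_measurable ?F"
    by (rule measurable_vimage_algebra1) auto
  have "(\<integral>\<^sup>+ \<omega>. ennreal (g (z \<omega>)) * indicator {\<omega> \<in> space M. y \<omega> = v} \<omega> \<partial>M)
    = (\<integral>\<^sup>+ \<omega>. ennreal (g (z \<omega>)) * ennreal (label_prob_given M z y v \<omega>) \<partial>M)"
    unfolding label_prob_given_def
    by (intro F.nn_integral_real_cond_exp_indicator[symmetric]) measurable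
  also have "\<dots> = (\<integral>\<^sup>+ \<omega>. ennreal (sigmoid (v * (\<beta> \<bullet> z \<omega>)) * g (z \<omega>)) \<partial>M)"
    using label_prob[OF v]
    by (intro nn_integral_cong_AE) (auto simp: ennreal_mult g_nonneg mult.commute)
  finally show ?thesis .
qed

lemma nn_integral_loss:
  assumes [measurable]: "\<And>v. l v \<in> borel_measurable borel" and nonneg: "\<And>v x. 0 \<le> l v x"
  shows "(\<integral>\<^sup>+ \<omega>. ennreal (l (y \<omega>) (z \<omega>)) \<partial>M)
    = (\<integral>\<^sup>+ \<omega>. ennreal (cond_loss l (z \<omega>)) \<partial>M)"
proof -
  let ?I = "\<lambda>v. indicator {\<omega> \<in> space M. y \<omega> = v}"
  have "(\<integral>\<^sup>+ \<omega>. ennreal (l (y \<omega>) (z \<omega>)) \<partial>M)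
    = (\<integral>\<^sup>+ \<omega>. ennreal (l 1 (z \<omega>)) * ?I 1 \<omega> + ennreal (l (- 1) (z \<omega>)) * ?I (- 1) \<omega> \<partial>M)"
    using y_values by (intro nn_integral_cong) (fastforce simp: indicator_def)
  also have "\<dots> = (\<integral>\<^sup>+ \<omega>. ennreal (l 1 (z \<omega>)) * ?I 1 \<omega> \<partial>M)
      + (\<integral>\<^sup>+ \<omega>. ennreal (l (- 1) (z \<omega>)) * ?I (- 1) \<omega> \<partial>M)"
    by (intro nn_integral_add) measurable
  also have "\<dots> = (\<integral>\<^sup>+ \<omega>. ennreal (sigmoid (1 * (\<beta> \<bullet> z \<omega>)) * l 1 (z \<omega>)) \<partial>M)
      + (\<integral>\<^sup>+ \<omega>. ennreal (sigmoid (- 1 * (\<beta> \<bullet> z \<omega>)) * l (- 1) (z \<omega>)) \<partial>M)"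
    using nonneg by (intro arg_cong2[where f = "(+)"] nn_integral_loss_label) auto
  also have "\<dots> = (\<integral>\<^sup>+ \<omega>. ennreal (sigmoid (1 * (\<beta> \<bullet> z \<omega>)) * l 1 (z \<omega>))
      + ennreal (sigmoid (- 1 * (\<beta> \<bullet> z \<omega>)) * l (- 1) (z \<omega>)) \<partial>M)"
    by (intro nn_integral_add[symmetric]) measurable
  finally show ?thesis
    by (simp add: cond_loss_def nonneg ennreal_plus[symmetric] del: ennreal_plus)
qed

text \<open>The comparison principle used for both losses. The constant \<open>C\<close> keeps the
  smaller risk finite, without which a pointwise strict gap need not survive integration.\<close>

lemma nn_integral_loss_less:
  assumes meas [measurable]:
      "\<And>v. l v \<in> borel_measurable borel" "\<And>v. l' v \<in> borel_measurable borel"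
    and nonneg: "\<And>v x. 0 \<le> l v x" "\<And>v x. 0 \<le> l' v x"
    and bounded: "\<And>x. cond_loss l x \<le> C"
    and le: "\<And>x. cond_loss l x \<le> cond_loss l' x"
    and less: "\<And>\<omega>. \<omega> \<in> space M \<Longrightarrow> P \<omega> \<Longrightarrow> cond_loss l (z \<omega>) < cond_loss l' (z \<omega>)"
    and pos: "\<P>(\<omega> in M. P \<omega>) > 0"
  shows "(\<integral>\<^sup>+ \<omega>. ennreal (l (y \<omega>) (z \<omega>)) \<partial>M) < (\<integral>\<^sup>+ \<omega>. ennreal (l' (y \<omega>) (z \<omega>)) \<partial>M)"
proof -
  have [measurable]: "cond_loss l \<in> borel_measurable borel" "cond_loss l' \<in> borel_measurable borel"
    unfolding cond_loss_def[abs_def] by measurable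
  have "(\<integral>\<^sup>+ \<omega>. ennreal (cond_loss l (z \<omega>)) \<partial>M) < (\<integral>\<^sup>+ \<omega>. ennreal (cond_loss l' (z \<omega>)) \<partial>M)"
  proof (rule nn_integral_less)
    have "(\<integral>\<^sup>+ \<omega>. ennreal (cond_loss l (z \<omega>)) \<partial>M) \<le> (\<integral>\<^sup>+ \<omega>. ennreal C \<partial>M)"
      by (intro nn_integral_mono ennreal_leI bounded)
    also have "\<dots> < \<infinity>"
      by (simp add: emeasure_space_1)
    finally show "(\<integral>\<^sup>+ \<omega>. ennreal (cond_loss l (z \<omega>)) \<partial>M) \<noteq> \<infinity>"
      by simp
    show "AE \<omega> in M. ennreal (cond_loss l (z \<omega>)) \<le> ennreal (cond_loss l' (z \<omega>))"
      by (simp add: ennreal_leI le)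
    show "\<not> (AE \<omega> in M. ennreal (cond_loss l' (z \<omega>)) \<le> ennreal (cond_loss l (z \<omega>)))"
    proof
      assume "AE \<omega> in M. ennreal (cond_loss l' (z \<omega>)) \<le> ennreal (cond_loss l (z \<omega>))"
      then have "AE \<omega> in M. \<not> P \<omega>"
      proof (rule AE_mp[OF _ AE_I2], intro impI notI)
        fix \<omega>
        assume "\<omega> \<in> space M" "P \<omega>"
          and "ennreal (cond_loss l' (z \<omega>)) \<le> ennreal (cond_loss l (z \<omega>))"
        \<comment> \<open>Excludes the case in which truncation to \<open>ennreal\<close> collapses
          both values to 0.\<close>
        moreover have "0 \<le> cond_loss l (z \<omega>)"
          by (simp add: cond_loss_def nonneg)
        ultimately show False
          using less[of \<omega>] by (simp add: ennreal_le_iff2)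
      qed
      then have "\<P>(\<omega> in M. P \<omega>) = 0"
        using AE_iff_measurable[of "{\<omega> \<in> space M. P \<omega>}" M "\<lambda>\<omega>. \<not> P \<omega>"]
        \<comment> \<open>If the event is not measurable, its \<open>measure\<close> is 0 by
          default.\<close>
        by (cases "{\<omega> \<in> space M. P \<omega>} \<in> events")
          (simp_all add: measure_notin_sets emeasure_eq_measure)
      then show False
        using pos by simp
    qed
  qed measurable
  then show ?thesis
    by (simp add: nn_integral_loss meas nonneg)
qed

lemma logistic_risk_less:
  assumes [measurable]: "h \<in> borel_measurable borel"
    and pos: "\<P>(\<omega> in M. h (z \<omega>) \<noteq> \<beta> \<bullet> z \<omega>) > 0"
  shows "logistic_risk M z y (\<lambda>x. \<beta> \<bullet> x) < logistic_risk M z y h"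
proof -
  define l where "l h v x = - ln (sigmoid (v * h x))" for h :: "real ^ 'k \<Rightarrow> real" and v x
  let ?u = "\<lambda>x. \<beta> \<bullet> x"
  have nonneg: "0 \<le> l h v x" for h v x
    by (simp add: l_def less_imp_le)
  have cond_loss_l: "cond_loss (l h) x = sigmoid (?u x) * - ln (sigmoid (h x))
      + (1 - sigmoid (?u x)) * - ln (1 - sigmoid (h x))" for h x
    by (simp add: cond_loss_def l_def sigmoid_uminus)
  have less: "cond_loss (l ?u) x < cond_loss (l h) x" if "h x \<noteq> ?u x" for h x
    unfolding cond_loss_l using that by (intro binary_cross_entropy_less) auto
  then have le: "cond_loss (l ?u) x \<le> cond_loss (l h) x" for h x
    by (cases "h x = ?u x") (auto simp: cond_loss_l intro: less_imp_le)
  \<comment> \<open>The zero score predicts 1/2 everywhere; comparing the Bayes score with it yields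
    the finite bound.\<close>
  have "cond_loss (l (\<lambda>_. 0)) x = ln 2" for x
    unfolding cond_loss_l by (simp add: sigmoid_def ln_div algebra_simps)
  then have bounded: "cond_loss (l ?u) x \<le> ln 2" for x
    using le by metis
  have [measurable]: "l h v \<in> borel_measurable borel" "l ?u v \<in> borel_measurable borel" for v
    unfolding l_def[abs_def] by measurable
  have "(\<integral>\<^sup>+ \<omega>. ennreal (l ?u (y \<omega>) (z \<omega>)) \<partial>M) < (\<integral>\<^sup>+ \<omega>. ennreal (l h (y \<omega>) (z \<omega>)) \<partial>M)"
    by (rule nn_integral_loss_less[where P = "\<lambda>\<omega>. h (z \<omega>) \<noteq> ?u (z \<omega>)"])
      (use nonneg bounded le less pos in auto)
  then show ?thesis
    by (simp add: logistic_risk_def l_def)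
qed

lemma zero_one_risk_less:
  assumes [measurable]: "h \<in> borel_measurable borel" and s: "s \<in> {1, - 1}"
    and pos: "\<P>(\<omega> in M. sgn (h (z \<omega>)) * sgn (\<beta> \<bullet> z \<omega>) < 0) > 0"
  shows "zero_one_risk s M z y (\<lambda>x. \<beta> \<bullet> x) < zero_one_risk s M z y h"
proof -
  define l where "l h v x = (if sign_conv s (h x) = v then 0 else 1 :: real)"
    for h :: "real ^ 'k \<Rightarrow> real" and v x
  let ?u = "\<lambda>x. \<beta> \<bullet> x"
  have nonneg: "0 \<le> l h v x" for h v x
    by (simp add: l_def)
  have half: "sigmoid 0 = 1 / 2"
    by (simp add: sigmoid_def)
  \<comment> \<open>The conditional 0-1 risk is the probability of the label that is not
    predicted.\<close>
  have cond_loss_l: "cond_loss (l h) x = (if sign_conv s (h x) = 1 then 1 - sigmoid (?u x)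
      else sigmoid (?u x))" for h x
    using s by (auto simp: cond_loss_def l_def sigmoid_uminus sign_conv_def sgn_real_def)
  have gt_half: "1 / 2 < sigmoid (?u x)" if "0 < ?u x" for x
    using that sigmoid_less_iff[of 0 "?u x"] by (simp only: half)
  have lt_half: "sigmoid (?u x) < 1 / 2" if "?u x < 0" for x
    using that sigmoid_less_iff[of "?u x" 0] by (simp only: half)
  \<comment> \<open>Where \<open>?u x = 0\<close> both labels have probability 1/2, so the
    convention \<open>s\<close> has no effect.\<close>
  have le: "cond_loss (l ?u) x \<le> cond_loss (l h) x" for h x
    using gt_half[of x] lt_half[of x] half
    by (cases "?u x" "0 :: real" rule: linorder_cases)
      (auto simp: cond_loss_l sign_conv_def)
  have less: "cond_loss (l ?u) x < cond_loss (l h) x" if "sgn (h x) * sgn (?u x) < 0" for h x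
    using that gt_half[of x] lt_half[of x]
    by (auto simp: cond_loss_l sign_conv_def sgn_real_def split: if_splits)
  have bounded: "cond_loss (l ?u) x \<le> 1" for x
    by (simp add: cond_loss_l less_imp_le)
  have [measurable]: "l h v \<in> borel_measurable borel" "l ?u v \<in> borel_measurable borel" for v
    unfolding l_def[abs_def] by measurable
  have risk: "ennreal (zero_one_risk s M z y h) = (\<integral>\<^sup>+ \<omega>. ennreal (l h (y \<omega>) (z \<omega>)) \<partial>M)"
    if [measurable]: "h \<in> borel_measurable borel" for h
  proof -
    have "ennreal (zero_one_risk s M z y h)
      = (\<integral>\<^sup>+ \<omega>. indicator {\<omega> \<in> space M. sign_conv s (h (z \<omega>)) \<noteq> y \<omega>} \<omega> \<partial>M)"
      unfolding zero_one_risk_def by (subst nn_integral_indicator) (auto simp: emeasure_eq_measure)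
    also have "\<dots> = (\<integral>\<^sup>+ \<omega>. ennreal (l h (y \<omega>) (z \<omega>)) \<partial>M)"
      by (intro nn_integral_cong) (simp add: l_def indicator_def)
    finally show ?thesis .
  qed
  have "(\<integral>\<^sup>+ \<omega>. ennreal (l ?u (y \<omega>) (z \<omega>)) \<partial>M) < (\<integral>\<^sup>+ \<omega>. ennreal (l h (y \<omega>) (z \<omega>)) \<partial>M)"
    by (rule nn_integral_loss_less[where P = "\<lambda>\<omega>. sgn (h (z \<omega>)) * sgn (?u (z \<omega>)) < 0"])
      (use nonneg bounded le less pos in auto)
  then have "ennreal (zero_one_risk s M z y ?u) < ennreal (zero_one_risk s M z y h)"
    by (simp add: risk)
  then show ?thesis
    by (simp add: ennreal_less_iff zero_one_risk_def)
qed

end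

theorem theorem8p2:
  fixes M :: "'a measure"
    and z :: "'a \<Rightarrow> real ^ 'k"
    and y :: "'a \<Rightarrow> real"
    and \<beta> :: "real ^ 'k"
    and S :: "'k set"
  assumes "prob_space M"
    and "z \<in> borel_measurable M"
    and "y \<in> borel_measurable M"
    and "\<forall>\<omega>\<in>space M. y \<omega> \<in> {1, - 1}"
    and "AE \<omega> in M. label_prob_given M z y 1 \<omega> = sigmoid (\<beta> \<bullet> z \<omega>)"
    and "AE \<omega> in M. label_prob_given M z y (- 1) \<omega> = sigmoid (- (\<beta> \<bullet> z \<omega>))"
    and "\<forall>T. T \<noteq> {} \<longrightarrow> \<P>(\<omega> in M. sub_inner T \<beta> (z \<omega>) \<noteq> 0) > 0"
    and "\<not> (\<exists>i. \<exists>c :: 'k \<Rightarrow> real. AE \<omega> in M. z \<omega> $ i = (\<Sum>j\<in>UNIV - {i}. c j * z \<omega> $ j))"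
    and "S \<subset> UNIV"
  shows "logistic_risk M z y (\<lambda>x. sub_inner S \<beta> x) > logistic_risk M z y (\<lambda>x. \<beta> \<bullet> x)
    \<and> (\<P>(\<omega> in M. \<bar>sub_inner (- S) \<beta> (z \<omega>)\<bar> > \<bar>sub_inner S \<beta> (z \<omega>)\<bar>
            \<and> sgn (sub_inner (- S) \<beta> (z \<omega>)) = - sgn (sub_inner S \<beta> (z \<omega>))) > 0
       \<longrightarrow> (\<forall>s\<in>{1, - 1}. zero_one_risk s M z y (\<lambda>x. sub_inner S \<beta> x)
                       > zero_one_risk s M z y (\<lambda>x. \<beta> \<bullet> x)))"
proof -
  interpret logistic_label M z y \<beta>
  proof (intro logistic_label.intro logistic_label_axioms.intro)
    show "AE \<omega> in M. label_prob_given M z y v \<omega> = sigmoid (v * (\<beta> \<bullet> z \<omega>))"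
      if "v \<in> {1, - 1}" for v
      using that assms(5,6) by auto
  qed (use assms in auto)
  let ?a = "\<lambda>\<omega>. sub_inner S \<beta> (z \<omega>)" and ?b = "\<lambda>\<omega>. sub_inner (- S) \<beta> (z \<omega>)"
  have u: "\<beta> \<bullet> z \<omega> = ?a \<omega> + ?b \<omega>" for \<omega>
    by (rule inner_eq_sub_inner)
  have "- S \<noteq> {}"
    using assms(9) by auto
  \<comment> \<open>The nonvanishing assumption at \<open>T = - S\<close>. By \<open>u\<close>, the
    two scores differ exactly where \<open>?b\<close> is nonzero.\<close>
  then have "\<P>(\<omega> in M. ?b \<omega> \<noteq> 0) > 0"
    using assms(7) by simp
  then have logistic:
    "logistic_risk M z y (\<lambda>x. \<beta> \<bullet> x) < logistic_risk M z y (\<lambda>x. sub_inner S \<beta> x)"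
    by (intro logistic_risk_less) (simp_all add: u)
  have zero_one:
    "zero_one_risk s M z y (\<lambda>x. \<beta> \<bullet> x) < zero_one_risk s M z y (\<lambda>x. sub_inner S \<beta> x)"
    if "s \<in> {1, - 1}"
      and pos: "\<P>(\<omega> in M. \<bar>?b \<omega>\<bar> > \<bar>?a \<omega>\<bar> \<and> sgn (?b \<omega>) = - sgn (?a \<omega>)) > 0" for s
  proof (rule zero_one_risk_less)
    \<comment> \<open>The larger magnitude makes \<open>b\<close> nonzero, hence also
      \<open>a\<close>, and the sum takes the sign of \<open>b\<close>.\<close>
    have "sgn a * sgn (a + b) < 0" if "\<bar>b\<bar> > \<bar>a\<bar>" "sgn b = - sgn a" for a b :: real
      using that by (auto simp: sgn_real_def split: if_splits)
    then have "\<P>(\<omega> in M. \<bar>?b \<omega>\<bar> > \<bar>?a \<omega>\<bar> \<and> sgn (?b \<omega>) = - sgn (?a \<omega>))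
        \<le> \<P>(\<omega> in M. sgn (?a \<omega>) * sgn (\<beta> \<bullet> z \<omega>) < 0)"
      unfolding u by (intro finite_measure_mono) (auto simp: sgn_real_def)
    with pos show "\<P>(\<omega> in M. sgn (?a \<omega>) * sgn (\<beta> \<bullet> z \<omega>) < 0) > 0"
      by linarith
  qed (use that in auto)
  show ?thesis
    using logistic zero_one by blast
qed

end
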